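(* Let $r\ge 0$ be an integer and let $M = \begin{pmatrix} A & B \\ J & A^{\dagger}\end{pmatrix}$ be the $(2r+2)\times(2r+2)$ $0,1$-matrix defined in the context. The $\mathbf{c}\mathbf{d}$-index series matrix $\Psi_M$ of the level (Eulerian) poset associated to $M$ is given by $$\Psi_M = \vec p\cdot \phi\cdot \vec p^{\,\dagger} + C,$$ where $\phi = \dfrac{1}{1-\mathbf{c}-r\mathbf{d}}$, $\vec p$ is the column vector with $\vec p^{\,T} = (1,\underbrace{\mathbf{c},\ldots,\mathbf{c}}_{r},\underbrace{1,\ldots,1}_{r+1})$, $\vec p^{\,\dagger}$ is the row vector $(\underbrace{1,\ldots,1}_{r+1},\underbrace{\mathbf{c},\ldots,\mathbf{c}}_{r},1)$, and $C=\begin{pmatrix}0&H\\0&0\end{pmatrix}$, where $H$ is the $(r+1)\times(r+1)$ matrix obtained from $B$ by subtracting $1$ from its upper right entry (so for $r=0$, $H=(0)$, and for $r\ge1$, $H=(h_{i,j})_{0\le i,j\le r}$ with $h_{i,j}=1$ if $0\le i-j\le1$, $h_{0,r}=-1$, and $h_{i,j}=0$ otherwise).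
   Context: Blocks (all $(r+1)\times(r+1)$, indexed by $0\le i,j\le r$): $A=(a_{i,j})$ with $a_{i,j}=1$ if $i=0$ and $0$ otherwise; $B=(b_{i,j})$ with $b_{i,j}=1$ if $0\le i-j\le 1$ and $0$ otherwise; $J$ is the all-ones matrix; $A^{\dagger}$ has $(A^{\dagger})_{i,j}=1$ if $j=r$ and $0$ otherwise. Rows and columns of $M$ are indexed by $0,\ldots,2r+1$. The level poset associated to a $0,1$-matrix $X=(x_{i,j})$ is the ranked poset on (index set) $\times\mathbb{Z}$ with cover relations $(i,s)\prec(j,s+1)$ iff $x_{i,j}=1$. For a graded poset $P$ with rank function $\rho$, minimal element $\hat0$ and maximal element $\hat1$, the $\mathbf{ab}$-index is the polynomial in the non-commutative variables $\mathbf a,\mathbf b$ $$\Psi(P)=\sum_{c}(\mathbf a-\mathbf b)^{\rho(x_0,x_1)-1}\,\mathbf b\,(\mathbf a-\mathbf b)^{\rho(x_1,x_2)-1}\,\mathbf b\cdots\mathbf b\,(\mathbf a-\mathbf b)^{\rho(x_k,x_{k+1})-1},$$ the sum being over all chains $c=\{\hat0=x_0<x_1<\cdots<x_k<x_{k+1}=\hat1\}$ ($k\ge0$), where $\rho(x,y)=\rho(y)-\rho(x)$. For Eulerian $P$ it is a polynomial in $\mathbf c=\mathbf a+\mathbf b$ and $\mathbf d=\mathbf a\mathbf b+\mathbf b\mathbf a$, called the $\mathbf{cd}$-index. For a level poset, $\Psi_M=(\Psi_{i,j})$ is the matrix with entries the formal series $\Psi_{i,j}=\sum_{k\ge1}\Psi([(i,0),(j,k)])$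 in $\mathbb{Z}\langle\langle\mathbf a,\mathbf b\rangle\rangle$, where the term is $0$ when $(i,0)\not\le(j,k)$. The identity is understood with $\mathbf c=\mathbf a+\mathbf b$, $\mathbf d=\mathbf a\mathbf b+\mathbf b\mathbf a$, and $\frac1{1-u}=\sum_{k\ge0}u^k$ for a series $u$ without constant term; products are non-commutative, so the $(i,j)$ entry of $\vec p\cdot\phi\cdot\vec p^{\,\dagger}$ is $(\vec p)_i\,\phi\,(\vec p^{\,\dagger})_j$. *)

theory Defs
  imports "Jordan_Normal_Form.Matrix" "HOL-Library.Groups_Big_Fun"
begin

section \<open>Formal power series in non-commuting variables\<close>

text \<open>The ring of formal series over the integers in non-commuting variables from \<open>'x\<close>;
  a series is determined by its coefficient at each word.\<close>

typedef 'x ncfps = "UNIV :: ('x list \<Rightarrow> int) set"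
  morphisms nc_coeff Abs_ncfps
  by simp

lemma nc_coeff_Abs [simp]: "nc_coeff (Abs_ncfps f) = f"
  by (simp add: Abs_ncfps_inverse)

lemma ncfps_eqI: "(\<And>w. nc_coeff f w = nc_coeff g w) \<Longrightarrow> f = g"
  by (metis ext nc_coeff_inject)

instantiation ncfps :: (type) ring_1
begin

definition "0 = Abs_ncfps (\<lambda>w. 0)"
definition "1 = Abs_ncfps (\<lambda>w. if w = [] then 1 else 0)"
definition "f + g = Abs_ncfps (\<lambda>w. nc_coeff f w + nc_coeff g w)"
definition "f - g = Abs_ncfps (\<lambda>w. nc_coeff f w - nc_coeff g w)"
definition "- f = Abs_ncfps (\<lambda>w. - nc_coeff f w)"
definition "f * g =
  Abs_ncfps (\<lambda>w. \<Sum>k\<le>length w. nc_coeff f (take k w) * nc_coeff g (drop k w))"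

lemma nc_coeff_ring_ops [simp]:
  "nc_coeff 0 w = 0"
  "nc_coeff 1 w = (if w = [] then 1 else 0)"
  "nc_coeff (f + g) w = nc_coeff f w + nc_coeff g w"
  "nc_coeff (f - g) w = nc_coeff f w - nc_coeff g w"
  "nc_coeff (- f) w = - nc_coeff f w"
  by (simp_all add: zero_ncfps_def one_ncfps_def plus_ncfps_def minus_ncfps_def uminus_ncfps_def)

lemma nc_coeff_mult:
  "nc_coeff (f * g) w = (\<Sum>k\<le>length w. nc_coeff f (take k w) * nc_coeff g (drop k w))"
  by (simp add: times_ncfps_def)

lemma ncfps_mult_assoc: "f * g * h = f * (g * h :: 'a ncfps)"
proof (rule ncfps_eqI)
  fix w :: "'a list"
  let ?n = "length w"
  let ?F = "\<lambda>j k. nc_coeff f (take j w) * nc_coeff g (take (k - j) (drop j w)) * nc_coeff h (drop k w)"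
  have "nc_coeff (f * g * h) w = (\<Sum>k\<le>?n. \<Sum>j\<le>k. ?F j k)"
    by (auto simp: nc_coeff_mult sum_distrib_right min_def drop_take intro!: sum.cong)
  also have "\<dots> = (\<Sum>(k,j)\<in>(SIGMA k:{..?n}. {..k}). ?F j k)"
    by (simp add: sum.Sigma)
  also have "\<dots> = (\<Sum>(j,l)\<in>(SIGMA j:{..?n}. {..?n - j}). ?F j (j + l))"
    by (rule sum.reindex_bij_witness[where i = "\<lambda>(j,l). (j + l, j)" and j = "\<lambda>(k,j). (j, k - j)"]) auto
  also have "\<dots> = (\<Sum>j\<le>?n. \<Sum>l\<le>?n - j. ?F j (j + l))"
    by (simp add: sum.Sigma)
  also have "\<dots> = nc_coeff (f * (g * h)) w"
    by (auto simp: nc_coeff_mult sum_distrib_left add.commute mult.assoc intro!: sum.cong)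
  finally show "nc_coeff (f * g * h) w = nc_coeff (f * (g * h)) w" .
qed

lemma ncfps_one_mult: "1 * f = (f :: 'a ncfps)"
proof (rule ncfps_eqI)
  fix w :: "'a list"
  have "nc_coeff (1 * f) w = (\<Sum>k\<le>length w. if k = 0 then nc_coeff f w else 0)"
    unfolding nc_coeff_mult by (rule sum.cong) auto
  then show "nc_coeff (1 * f) w = nc_coeff f w" by simp
qed

lemma ncfps_mult_one: "f * 1 = (f :: 'a ncfps)"
proof (rule ncfps_eqI)
  fix w :: "'a list"
  have "nc_coeff (f * 1) w = (\<Sum>k\<le>length w. if k = length w then nc_coeff f w else 0)"
    unfolding nc_coeff_mult by (rule sum.cong) auto
  then show "nc_coeff (f * 1) w = nc_coeff f w" by simp
qed

instance
proof
  fix f g h :: "'a ncfps"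
  show "f * g * h = f * (g * h)" by (rule ncfps_mult_assoc)
  show "1 * f = f" by (rule ncfps_one_mult)
  show "f * 1 = f" by (rule ncfps_mult_one)
  show "(f + g) * h = f * h + g * h" "f * (g + h) = f * g + f * h"
    by (auto intro!: ncfps_eqI simp: nc_coeff_mult sum.distrib algebra_simps)
  have "nc_coeff 0 [] \<noteq> nc_coeff (1 :: 'a ncfps) []" by simp
  then show "(0 :: 'a ncfps) \<noteq> 1" by metis
qed (auto intro!: ncfps_eqI)

end

definition nc_var :: "'x \<Rightarrow> 'x ncfps" where
  "nc_var x = Abs_ncfps (\<lambda>w. if w = [x] then 1 else 0)"

text \<open>Infinite sums of series are taken coefficientwise. This is meaningful for families in which
  each word has a nonzero coefficient in only finitely many members, as is the case wherever it is
  used below.\<close>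

definition nc_suminf :: "(nat \<Rightarrow> 'x ncfps) \<Rightarrow> 'x ncfps" where
  "nc_suminf F = Abs_ncfps (\<lambda>w. Sum_any (\<lambda>k. nc_coeff (F k) w))"

definition nc_geom :: "'x ncfps \<Rightarrow> 'x ncfps" where
  "nc_geom u = nc_suminf (\<lambda>k. u ^ k)"

lemma nc_coeff_power_eq_0:
  assumes "nc_coeff u [] = 0"
  shows "length w < k \<Longrightarrow> nc_coeff (u ^ k) w = 0"
proof (induction k arbitrary: w)
  case (Suc k)
  have "nc_coeff u (take i w) * nc_coeff (u ^ k) (drop i w) = 0" if "i \<le> length w" for i
  proof (cases "i = 0")
    case False
    then have "length (drop i w) < k" using that Suc.prems by auto
    then show ?thesis using Suc.IH by simp
  qed (simp add: assms)
  then have "(\<Sum>i\<le>length w. nc_coeff u (take i w) * nc_coeff (u ^ k) (drop i w)) = 0"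
    by (intro sum.neutral) auto
  then show ?case by (simp only: power_Suc nc_coeff_mult)
qed simp

lemma nc_coeff_geom:
  assumes "nc_coeff u [] = 0" and "length w \<le> n"
  shows "nc_coeff (nc_geom u) w = (\<Sum>k\<le>n. nc_coeff (u ^ k) w)"
  unfolding nc_geom_def nc_suminf_def nc_coeff_Abs
  by (rule Sum_any.expand_superset)
    (use assms nc_coeff_power_eq_0[OF assms(1)] in \<open>force simp: not_le[symmetric]\<close>)+

lemma nc_geom_inverse:
  assumes "nc_coeff u [] = 0"
  shows "(1 - u) * nc_geom u = 1"
proof (rule ncfps_eqI)
  fix w :: "'a list"
  let ?n = "length w"
  have sum_coeff: "nc_coeff (\<Sum>k\<le>m. G k) v = (\<Sum>k\<le>m. nc_coeff (G k) v)" for m and G :: "nat \<Rightarrow> 'a ncfps" and v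
    by (induction m) auto
  have telescope: "(1 - u) * (\<Sum>k\<le>m. u ^ k) = 1 - u ^ Suc m" for m
    by (induction m) (simp_all add: distrib_left left_diff_distrib)
  have "nc_coeff ((1 - u) * nc_geom u) w = nc_coeff ((1 - u) * (\<Sum>k\<le>?n. u ^ k)) w"
    by (auto simp: nc_coeff_mult sum_coeff nc_coeff_geom[OF assms, where n = ?n] intro!: sum.cong)
  also have "(1 - u) * (\<Sum>k\<le>?n. u ^ k) = 1 - u ^ Suc ?n"
    by (rule telescope)
  also have "nc_coeff \<dots> w = nc_coeff 1 w"
    using nc_coeff_power_eq_0[OF assms, of w "Suc ?n"] by (simp del: power_Suc)
  finally show "nc_coeff ((1 - u) * nc_geom u) w = nc_coeff 1 w" .
qed

datatype ab = Letter_a | Letter_b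

definition va :: "ab ncfps" where "va = nc_var Letter_a"
definition vb :: "ab ncfps" where "vb = nc_var Letter_b"
definition vc :: "ab ncfps" where "vc = va + vb"
definition vd :: "ab ncfps" where "vd = va * vb + vb * va"


section \<open>The ab-index of a graded poset\<close>

text \<open>A poset is given by its carrier \<open>P\<close> and its (reflexive) order relation \<open>R\<close>. A chain
  \<open>x\<^sub>0 < x\<^sub>1 < \<dots> < x\<^sub>k\<^sub>+\<^sub>1\<close> from the minimal to the maximal element is the list of its elements in
  increasing order. The rank function \<open>\<rho>\<close> matters only up to an additive constant, so it may take
  arbitrary integer values.\<close>

definition bounded_chains :: "'p set \<Rightarrow> ('p \<times> 'p) set \<Rightarrow> 'p list set" where
  "bounded_chains P R = {xs. length xs \<ge> 2 \<and> set xs \<subseteq> P \<and>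
     sorted_wrt (\<lambda>x y. (x, y) \<in> R \<and> x \<noteq> y) xs \<and>
     (\<forall>y\<in>P. (hd xs, y) \<in> R) \<and> (\<forall>y\<in>P. (y, last xs) \<in> R)}"

fun chain_weight :: "('p \<Rightarrow> int) \<Rightarrow> 'p list \<Rightarrow> ab ncfps" where
  "chain_weight \<rho> (x # y # z # xs) =
     (va - vb) ^ nat (\<rho> y - \<rho> x - 1) * vb * chain_weight \<rho> (y # z # xs)"
| "chain_weight \<rho> [x, y] = (va - vb) ^ nat (\<rho> y - \<rho> x - 1)"
| "chain_weight \<rho> [x] = 1"
| "chain_weight \<rho> [] = 1"

definition ab_index :: "'p set \<Rightarrow> ('p \<times> 'p) set \<Rightarrow> ('p \<Rightarrow> int) \<Rightarrow> ab ncfps" where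
  "ab_index P R \<rho> = (\<Sum>xs\<in>bounded_chains P R. chain_weight \<rho> xs)"

definition poset_interval :: "('p \<times> 'p) set \<Rightarrow> 'p \<Rightarrow> 'p \<Rightarrow> 'p set" where
  "poset_interval R x y = {z. (x, z) \<in> R \<and> (z, y) \<in> R}"

lemma finite_bounded_chains:
  assumes "finite P"
  shows "finite (bounded_chains P R)"
proof (rule finite_subset)
  have "distinct xs" if "sorted_wrt (\<lambda>x y. (x, y) \<in> R \<and> x \<noteq> y) xs" for xs
    using that by (induction xs) auto
  then show "bounded_chains P R \<subseteq> {xs. set xs \<subseteq> P \<and> distinct xs}"
    by (auto simp: bounded_chains_def)
  show "finite {xs. set xs \<subseteq> P \<and> distinct xs}"
    by (rule finite_subset_distinct[OF assms])
qed


section \<open>Level posets\<close>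

definition level_carrier :: "int mat \<Rightarrow> (nat \<times> int) set" where
  "level_carrier X = {0..<dim_row X} \<times> UNIV"

definition level_cover :: "int mat \<Rightarrow> ((nat \<times> int) \<times> (nat \<times> int)) set" where
  "level_cover X =
     {((i, s), (j, s + 1)) | i j s. i < dim_row X \<and> j < dim_col X \<and> X $$ (i, j) = 1}"

definition level_le :: "int mat \<Rightarrow> ((nat \<times> int) \<times> (nat \<times> int)) set" where
  "level_le X = (level_cover X)\<^sup>* \<inter> level_carrier X \<times> level_carrier X"

lemma level_cover_rtrancl_snd:
  assumes "(x, y) \<in> (level_cover X)\<^sup>*"
  shows "snd x \<le> snd y \<and> (snd x = snd y \<longrightarrow> x = y)"
  using assms by (induction rule: rtrancl_induct) (auto simp: level_cover_def)

lemma partial_order_on_level_le: "partial_order_on (level_carrier X) (level_le X)"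
  unfolding partial_order_on_def preorder_on_def
proof (intro conjI)
  show "antisym (level_le X)"
  proof (rule antisymI)
    fix x y assume "(x, y) \<in> level_le X" "(y, x) \<in> level_le X"
    then have "(x, y) \<in> (level_cover X)\<^sup>*" "(y, x) \<in> (level_cover X)\<^sup>*"
      by (auto simp: level_le_def)
    from this[THEN level_cover_rtrancl_snd] show "x = y" by auto
  qed
qed (auto simp: level_le_def refl_on_def intro!: transI intro: rtrancl_trans)

lemma finite_level_interval: "finite (poset_interval (level_le X) x y)"
proof (rule finite_subset)
  show "poset_interval (level_le X) x y \<subseteq> {0..<dim_row X} \<times> {snd x..snd y}"
    using level_cover_rtrancl_snd
    by (force simp: poset_interval_def level_le_def level_carrier_def)
qed simp

text \<open>The rank function of a level poset is \<open>(i, s) \<mapsto> s\<close>.\<close>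

definition level_Psi :: "int mat \<Rightarrow> nat \<Rightarrow> nat \<Rightarrow> ab ncfps" where
  "level_Psi X i j = nc_suminf (\<lambda>k.
     if k \<ge> 1 \<and> ((i, 0), (j, int k)) \<in> level_le X
     then ab_index (poset_interval (level_le X) (i, 0) (j, int k)) (level_le X) snd
     else 0)"

definition Psi_mat :: "int mat \<Rightarrow> ab ncfps mat" where
  "Psi_mat X = mat (dim_row X) (dim_col X) (\<lambda>(i, j). level_Psi X i j)"


section \<open>The block matrices\<close>

definition block_A :: "nat \<Rightarrow> int mat" where
  "block_A r = mat (r + 1) (r + 1) (\<lambda>(i, j). if i = 0 then 1 else 0)"

definition block_B :: "nat \<Rightarrow> int mat" where
  "block_B r = mat (r + 1) (r + 1)
     (\<lambda>(i, j). if 0 \<le> int i - int j \<and> int i - int j \<le> 1 then 1 else 0)"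

definition block_J :: "nat \<Rightarrow> int mat" where
  "block_J r = mat (r + 1) (r + 1) (\<lambda>(i, j). 1)"

definition block_A_dagger :: "nat \<Rightarrow> int mat" where
  "block_A_dagger r = mat (r + 1) (r + 1) (\<lambda>(i, j). if j = r then 1 else 0)"

definition matrix_M :: "nat \<Rightarrow> int mat" where
  "matrix_M r = four_block_mat (block_A r) (block_B r) (block_J r) (block_A_dagger r)"

definition block_H :: "nat \<Rightarrow> int mat" where
  "block_H r = mat (r + 1) (r + 1)
     (\<lambda>(i, j). block_B r $$ (i, j) - (if i = 0 \<and> j = r then 1 else 0))"

definition matrix_C :: "nat \<Rightarrow> ab ncfps mat" where
  "matrix_C r = four_block_mat (0\<^sub>m (r + 1) (r + 1)) (map_mat of_int (block_H r))
     (0\<^sub>m (r + 1) (r + 1)) (0\<^sub>m (r + 1) (r + 1))"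

definition vec_p :: "nat \<Rightarrow> ab ncfps mat" where
  "vec_p r = mat (2 * r + 2) 1 (\<lambda>(i, _). if 1 \<le> i \<and> i \<le> r then vc else 1)"

definition vec_p_dagger :: "nat \<Rightarrow> ab ncfps mat" where
  "vec_p_dagger r = mat 1 (2 * r + 2) (\<lambda>(_, j). if r + 1 \<le> j \<and> j \<le> 2 * r then vc else 1)"

text \<open>In the product \<open>p \<cdot> \<phi> \<cdot> p\<^sup>\<dagger>\<close> the scalar \<open>\<phi>\<close> enters as a \<open>1 \<times> 1\<close> matrix, so that the
  entries are \<open>p\<^sub>i \<phi> p\<^sup>\<dagger>\<^sub>j\<close> in this order.\<close>

definition phi :: "nat \<Rightarrow> ab ncfps" where
  "phi r = nc_geom (vc + of_nat r * vd)"

end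

theory Submission
  imports Defs
begin

text \<open>Put \<open>e = a - b\<close>. Splitting a chain at its second element gives \<open>\<Psi> = K + K b \<Psi>\<close>, where
  \<open>K\<^sub>i\<^sub>j\<close> is the sum of \<open>e\<^sup>k\<close> over those \<open>k\<close> for which there is a path of length \<open>k + 1\<close> from \<open>i\<close> to \<open>j\<close>.
  For \<open>M\<close> such paths exist for all \<open>i, j\<close> as soon as \<open>k \<ge> 2\<close>, hence \<open>L = (1 - e) K\<close> is a polynomial
  matrix, and \<open>(1 - e) \<Psi> = L + L b \<Psi>\<close>. As \<open>e\<close> and \<open>L b\<close> have no constant terms, this linear system
  has only one solution. That the claimed matrix solves it comes down to
  \<open>(1 - c - r d) \<phi> = 1\<close>.\<close>

section \<open>Homogeneous series\<close>

definition nc_homogeneous :: "nat \<Rightarrow> 'x ncfps \<Rightarrow> bool" where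
  "nc_homogeneous n f \<longleftrightarrow> (\<forall>w. length w \<noteq> n \<longrightarrow> nc_coeff f w = 0)"

text \<open>When each \<open>G n\<close> is homogeneous of degree \<open>n\<close>, this is the
  infinite sum of all \<open>G n\<close>: at a word \<open>w\<close> only the member of index
  \<open>length w\<close> can contribute.\<close>

definition nc_graded_sum :: "(nat \<Rightarrow> 'x ncfps) \<Rightarrow> 'x ncfps" where
  "nc_graded_sum G = Abs_ncfps (\<lambda>w. nc_coeff (G (length w)) w)"

lemma nc_coeff_sum: "nc_coeff (\<Sum>x\<in>A. f x) w = (\<Sum>x\<in>A. nc_coeff (f x) w)"
  by (induction A rule: infinite_finite_induct) auto

lemma nc_homogeneous_0: "nc_homogeneous n 0"
  and nc_homogeneous_1: "nc_homogeneous 0 1"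
  and nc_homogeneous_var: "nc_homogeneous 1 (nc_var x)"
  and nc_homogeneous_add: "nc_homogeneous n f \<Longrightarrow> nc_homogeneous n g \<Longrightarrow> nc_homogeneous n (f + g)"
  and nc_homogeneous_diff: "nc_homogeneous n f \<Longrightarrow> nc_homogeneous n g \<Longrightarrow> nc_homogeneous n (f - g)"
  and nc_homogeneous_sum: "(\<And>x. x \<in> A \<Longrightarrow> nc_homogeneous n (F x)) \<Longrightarrow> nc_homogeneous n (sum F A)"
  by (auto simp: nc_homogeneous_def nc_var_def nc_coeff_sum)

lemma nc_homogeneous_mult:
  assumes "nc_homogeneous m f" "nc_homogeneous n g"
  shows "nc_homogeneous (m + n) (f * g)"
  unfolding nc_homogeneous_def
proof (intro allI impI)
  fix w :: "'a list" assume w: "length w \<noteq> m + n"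
  have "nc_coeff f (take k w) * nc_coeff g (drop k w) = 0" if "k \<le> length w" for k
    using assms w that by (cases "k = m") (auto simp: nc_homogeneous_def)
  then show "nc_coeff (f * g) w = 0" unfolding nc_coeff_mult by (intro sum.neutral) blast
qed

lemma nc_homogeneous_power:
  assumes "nc_homogeneous 1 f"
  shows "nc_homogeneous n (f ^ n)"
  using nc_homogeneous_mult[OF assms] by (induction n) (auto simp: nc_homogeneous_1)

lemma nc_homogeneous_of_bool: "nc_homogeneous n f \<Longrightarrow> nc_homogeneous n (of_bool P * f)"
  by (simp add: nc_homogeneous_0)

lemma nc_homogeneous_vb: "nc_homogeneous 1 vb"
  unfolding vb_def by (rule nc_homogeneous_var)

lemma nc_homogeneous_va_minus_vb: "nc_homogeneous 1 (va - vb)"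
  unfolding va_def vb_def by (intro nc_homogeneous_diff nc_homogeneous_var)

lemma nc_coeff_graded_sum: "nc_coeff (nc_graded_sum G) w = nc_coeff (G (length w)) w"
  by (simp add: nc_graded_sum_def)

lemma nc_graded_sum_add: "nc_graded_sum (\<lambda>n. F n + G n) = nc_graded_sum F + nc_graded_sum G"
  by (rule ncfps_eqI) (simp add: nc_coeff_graded_sum)

lemma nc_graded_sum_diff: "nc_graded_sum (\<lambda>n. F n - G n) = nc_graded_sum F - nc_graded_sum G"
  by (rule ncfps_eqI) (simp add: nc_coeff_graded_sum)

lemma nc_graded_sum_sum: "nc_graded_sum (\<lambda>n. \<Sum>x\<in>A. F x n) = (\<Sum>x\<in>A. nc_graded_sum (F x))"
  by (rule ncfps_eqI) (simp add: nc_coeff_graded_sum nc_coeff_sum)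

lemma nc_graded_sum_single:
  assumes "nc_homogeneous m f"
  shows "nc_graded_sum (\<lambda>n. if n = m then f else 0) = f"
  using assms by (intro ncfps_eqI) (auto simp: nc_coeff_graded_sum nc_homogeneous_def)

text \<open>Cauchy product by degree. Homogeneity of \<open>F m\<close> leaves the cut after
  \<open>m\<close> letters as the only one contributing to \<open>F m * G (n - m)\<close>.\<close>

lemma nc_graded_sum_mult:
  assumes F: "\<And>n. nc_homogeneous n (F n)" and G: "\<And>n. nc_homogeneous n (G n)"
  shows "nc_graded_sum F * nc_graded_sum G = nc_graded_sum (\<lambda>n. \<Sum>m\<le>n. F m * G (n - m))"
proof (rule ncfps_eqI)
  fix w :: "'a list"
  let ?n = "length w"
  have *: "nc_coeff (F m * G (?n - m)) w = nc_coeff (F m) (take m w) * nc_coeff (G (?n - m)) (drop m w)"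
    if "m \<le> ?n" for m
  proof -
    have "nc_coeff (F m * G (?n - m)) w =
      (\<Sum>k\<le>?n. if k = m then nc_coeff (F m) (take m w) * nc_coeff (G (?n - m)) (drop m w) else 0)"
      unfolding nc_coeff_mult
      using F[of m] by (intro sum.cong) (auto simp: nc_homogeneous_def)
    then show ?thesis using that by simp
  qed
  show "nc_coeff (nc_graded_sum F * nc_graded_sum G) w
      = nc_coeff (nc_graded_sum (\<lambda>n. \<Sum>m\<le>n. F m * G (n - m))) w"
    by (simp add: nc_coeff_mult[of "nc_graded_sum F"] nc_coeff_graded_sum nc_coeff_sum *)
qed

lemma nc_graded_sum_mult_left:
  assumes f: "nc_homogeneous 1 f" and G: "\<And>n. nc_homogeneous n (G n)"
  shows "f * nc_graded_sum G = nc_graded_sum (\<lambda>n. if n = 0 then 0 else f * G (n - 1))"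
proof -
  have "f * nc_graded_sum G = nc_graded_sum (\<lambda>n. if n = 1 then f else 0) * nc_graded_sum G"
    using f by (simp only: nc_graded_sum_single)
  also have "\<dots> = nc_graded_sum (\<lambda>n. \<Sum>m\<le>n. if m = 1 then f * G (n - 1) else 0)"
  proof (subst nc_graded_sum_mult)
    show "nc_homogeneous n (if n = 1 then f else 0)" for n
      using f by (simp add: nc_homogeneous_0)
    show "nc_graded_sum (\<lambda>n. \<Sum>m\<le>n. (if m = 1 then f else 0) * G (n - m))
        = nc_graded_sum (\<lambda>n. \<Sum>m\<le>n. if m = 1 then f * G (n - 1) else 0)"
      by (intro arg_cong[of _ _ nc_graded_sum] ext sum.cong) auto
  qed (rule G)
  also have "\<dots> = nc_graded_sum (\<lambda>n. if n = 0 then 0 else f * G (n - 1))"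
    by (auto intro!: arg_cong[of _ _ nc_graded_sum] ext)
  finally show ?thesis .
qed

text \<open>The index shift reflects that an interval of rank \<open>k\<close> has an ab-index of
  degree \<open>k - 1\<close>.\<close>

lemma nc_suminf_eq_graded_sum:
  assumes "F 0 = 0" and F: "\<And>n. nc_homogeneous n (F (Suc n))"
  shows "nc_suminf F = nc_graded_sum (\<lambda>n. F (Suc n))"
proof (rule ncfps_eqI)
  fix w
  have "nc_coeff (F k) w = 0" if "k \<noteq> Suc (length w)" for k
    using assms that by (cases k) (auto simp: nc_homogeneous_def)
  then have "Sum_any (\<lambda>k. nc_coeff (F k) w) = (\<Sum>k\<in>{Suc (length w)}. nc_coeff (F k) w)"
    by (intro Sum_any.expand_superset) auto
  then show "nc_coeff (nc_suminf F) w = nc_coeff (nc_graded_sum (\<lambda>n. F (Suc n))) w"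
    by (simp add: nc_suminf_def nc_coeff_graded_sum)
qed

text \<open>Induction on word length: as \<open>X i l\<close> has no constant term, the coefficient
  of \<open>X i l * F l\<close> at \<open>w\<close> involves only coefficients of \<open>F l\<close>
  at proper suffixes of \<open>w\<close>.\<close>

lemma ncfps_linear_system_unique:
  fixes X :: "'i \<Rightarrow> 'i \<Rightarrow> 'x ncfps"
  assumes X: "\<And>i l. nc_coeff (X i l) [] = 0"
    and F: "\<And>i. i \<in> A \<Longrightarrow> F i = L i + (\<Sum>l\<in>A. X i l * F l)"
    and G: "\<And>i. i \<in> A \<Longrightarrow> G i = L i + (\<Sum>l\<in>A. X i l * G l)"
    and "i \<in> A"
  shows "F i = G i"
proof (rule ncfps_eqI)
  fix w
  show "nc_coeff (F i) w = nc_coeff (G i) w"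
    using \<open>i \<in> A\<close>
  proof (induction w arbitrary: i rule: length_induct)
    case (1 w)
    have "nc_coeff (X i l * F l) w = nc_coeff (X i l * G l) w" if "l \<in> A" for l
      unfolding nc_coeff_mult
    proof (rule sum.cong[OF refl])
      fix k assume "k \<in> {..length w}"
      then show "nc_coeff (X i l) (take k w) * nc_coeff (F l) (drop k w)
          = nc_coeff (X i l) (take k w) * nc_coeff (G l) (drop k w)"
        using 1 that X by (cases "k = 0") auto
    qed
    then show ?case
      using F[OF "1.prems"] G[OF "1.prems"] by (simp add: nc_coeff_sum)
  qed
qed

section \<open>Recursion for the ab-index\<close>

text \<open>Fixing the endpoints instead of a carrier makes the tail of a chain, if it still has two
  elements, a chain of the same kind.\<close>

definition chains_between :: "('p \<times> 'p) set \<Rightarrow> 'p \<Rightarrow> 'p \<Rightarrow> 'p list set" where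
  "chains_between R x y = {xs. length xs \<ge> 2 \<and> hd xs = x \<and> last xs = y \<and>
     sorted_wrt (\<lambda>x y. (x, y) \<in> R \<and> x \<noteq> y) xs}"

lemma sorted_wrt_hd_last:
  assumes "sorted_wrt P xs" "z \<in> set xs"
  shows "z = hd xs \<or> P (hd xs) z" "z = last xs \<or> P z (last xs)"
proof -
  show "z = hd xs \<or> P (hd xs) z" using assms by (cases xs) auto
  show "z = last xs \<or> P z (last xs)" using assms by (cases xs rule: rev_cases) (auto simp: sorted_wrt_append)
qed

text \<open>Antisymmetry identifies the ends of a bounded chain with \<open>x\<close> and
  \<open>y\<close>. Conversely \<open>sorted_wrt\<close> compares all pairs, so each member of a
  chain lies between its ends.\<close>

lemma bounded_chains_interval:
  assumes R: "antisym R" "(x, x) \<in> R" "(y, y) \<in> R" "(x, y) \<in> R"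
  shows "bounded_chains (poset_interval R x y) R = chains_between R x y"
proof (intro equalityI subsetI)
  fix xs assume xs: "xs \<in> bounded_chains (poset_interval R x y) R"
  then have "xs \<noteq> []" by (auto simp: bounded_chains_def)
  then have "hd xs \<in> set xs" "last xs \<in> set xs" by auto
  then have "hd xs \<in> poset_interval R x y" "last xs \<in> poset_interval R x y"
    "(hd xs, x) \<in> R" "(y, last xs) \<in> R"
    using xs R by (auto simp: bounded_chains_def poset_interval_def)
  then have "hd xs = x" "last xs = y"
    using R(1) by (auto simp: poset_interval_def dest: antisymD)
  then show "xs \<in> chains_between R x y" using xs by (auto simp: bounded_chains_def chains_between_def)
next
  fix xs assume xs: "xs \<in> chains_between R x y"
  then have "set xs \<subseteq> poset_interval R x y"
    using R sorted_wrt_hd_last[of "\<lambda>x y. (x, y) \<in> R \<and> x \<noteq> y" xs]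
    by (fastforce simp: chains_between_def poset_interval_def)
  then show "xs \<in> bounded_chains (poset_interval R x y) R"
    using xs by (auto simp: bounded_chains_def chains_between_def poset_interval_def)
qed

lemma chains_between_rec:
  assumes R: "antisym R" "trans R" and xy: "(x, y) \<in> R" "x \<noteq> y"
  shows "chains_between R x y = insert [x, y]
    (\<Union>z\<in>poset_interval R x y - {x, y}. (#) x ` chains_between R z y)"
proof (intro equalityI subsetI)
  fix xs assume xs: "xs \<in> chains_between R x y"
  then obtain z zs where xs_eq: "xs = x # z # zs"
    by (cases xs; cases "tl xs") (auto simp: chains_between_def)
  show "xs \<in> insert [x, y] (\<Union>z\<in>poset_interval R x y - {x, y}. (#) x ` chains_between R z y)"
  proof (cases zs)
    case Nil
    then show ?thesis using xs xs_eq by (auto simp: chains_between_def)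
  next
    case (Cons u us)
    then have "y \<in> set zs" "z # zs \<in> chains_between R z y"
      using xs xs_eq by (auto simp: chains_between_def)
    moreover from this have "z \<in> poset_interval R x y - {x, y}"
      using xs xs_eq by (auto simp: chains_between_def poset_interval_def)
    ultimately show ?thesis
      using xs_eq by blast
  qed
next
  fix xs assume "xs \<in> insert [x, y] (\<Union>z\<in>poset_interval R x y - {x, y}. (#) x ` chains_between R z y)"
  then consider "xs = [x, y]"
    | z ys where "xs = x # ys" "ys \<in> chains_between R z y" "(x, z) \<in> R" "x \<noteq> z"
    by (auto simp: poset_interval_def)
  then show "xs \<in> chains_between R x y"
  proof cases
    case 1 then show ?thesis using xy by (auto simp: chains_between_def)
  next
    case (2 z ys)
    \<comment> \<open>Transitivity through \<open>z\<close> relates \<open>x\<close> to every later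
      element, and \<open>x = u\<close> would force \<open>x = z\<close> by antisymmetry.\<close>
    have "(x, u) \<in> R \<and> x \<noteq> u" if "u \<in> set ys" for u
      using sorted_wrt_hd_last(1)[OF _ that, of "\<lambda>x y. (x, y) \<in> R \<and> x \<noteq> y"] 2 R
      by (auto simp: chains_between_def dest: transD antisymD)
    then show ?thesis using 2 by (auto simp: chains_between_def)
  qed
qed

text \<open>Chains are sorted by their second element \<open>z\<close>: \<open>[x, y]\<close> gives
  the bare power, and every other weight splits off a factor depending only on \<open>x\<close> and
  \<open>z\<close>.\<close>

lemma ab_index_interval_rec:
  assumes R: "antisym R" "trans R" "(x, x) \<in> R" "(y, y) \<in> R"
    "\<And>z. z \<in> poset_interval R x y \<Longrightarrow> (z, z) \<in> R"
    and xy: "(x, y) \<in> R" "x \<noteq> y" and fin: "finite (poset_interval R x y)"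
  shows "ab_index (poset_interval R x y) R \<rho> = (va - vb) ^ nat (\<rho> y - \<rho> x - 1) +
    (\<Sum>z\<in>poset_interval R x y - {x, y}. (va - vb) ^ nat (\<rho> z - \<rho> x - 1) * vb *
       ab_index (poset_interval R z y) R \<rho>)"
proof -
  let ?I = "poset_interval R x y - {x, y}"
  have I: "bounded_chains (poset_interval R z y) R = chains_between R z y"
    "finite (chains_between R z y)" if "z \<in> poset_interval R x y" for z
  proof -
    show eq: "bounded_chains (poset_interval R z y) R = chains_between R z y"
      using R that by (intro bounded_chains_interval) (auto simp: poset_interval_def)
    have "poset_interval R z y \<subseteq> poset_interval R x y"
      using that R(2) by (auto simp: poset_interval_def dest: transD)
    then show "finite (chains_between R z y)"
      using finite_bounded_chains[of "poset_interval R z y" R] fin by (auto simp: eq dest: finite_subset)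
  qed
  \<comment> \<open>Chains from \<open>z\<close> to \<open>y\<close> have length at least 2, so
    putting \<open>x\<close> in front gives length at least 3.\<close>
  have not: "[x, y] \<notin> (\<Union>z\<in>?I. (#) x ` chains_between R z y)"
    by (auto simp: chains_between_def)
  have "ab_index (poset_interval R x y) R \<rho> = (\<Sum>xs\<in>chains_between R x y. chain_weight \<rho> xs)"
    using xy R(4) unfolding ab_index_def by (subst I(1)) (auto simp: poset_interval_def R(3))
  also have "\<dots> = chain_weight \<rho> [x, y] +
      (\<Sum>xs\<in>(\<Union>z\<in>?I. (#) x ` chains_between R z y). chain_weight \<rho> xs)"
    unfolding chains_between_rec[OF R(1,2) xy]
    using fin I not by (intro sum.insert) auto
  also have "(\<Sum>xs\<in>(\<Union>z\<in>?I. (#) x ` chains_between R z y). chain_weight \<rho> xs)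
      = (\<Sum>z\<in>?I. \<Sum>xs\<in>(#) x ` chains_between R z y. chain_weight \<rho> xs)"
    using fin I by (intro sum.UNION_disjoint) (auto simp: chains_between_def)
  also have "\<dots> = (\<Sum>z\<in>?I. (va - vb) ^ nat (\<rho> z - \<rho> x - 1) * vb * ab_index (poset_interval R z y) R \<rho>)"
  proof (rule sum.cong[OF refl])
    fix z assume z: "z \<in> ?I"
    have w: "chain_weight \<rho> (x # ys) = (va - vb) ^ nat (\<rho> z - \<rho> x - 1) * vb * chain_weight \<rho> ys"
      if "ys \<in> chains_between R z y" for ys
      using that by (cases ys; cases "tl ys") (auto simp: chains_between_def)
    show "(\<Sum>xs\<in>(#) x ` chains_between R z y. chain_weight \<rho> xs)
        = (va - vb) ^ nat (\<rho> z - \<rho> x - 1) * vb * ab_index (poset_interval R z y) R \<rho>"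
      using z by (simp add: sum.reindex inj_on_def ab_index_def I w sum_distrib_left)
  qed
  finally show ?thesis by simp
qed


section \<open>Level posets as transfer matrices\<close>

definition level_graph :: "int mat \<Rightarrow> (nat \<times> nat) set" where
  "level_graph X = {(i, j). i < dim_row X \<and> j < dim_col X \<and> X $$ (i, j) = 1}"

text \<open>Every cover raises the level by exactly 1, so the levels of the endpoints fix the path
  length.\<close>

lemma level_cover_rtrancl_iff:
  "((i, s), (j, t)) \<in> (level_cover X)\<^sup>* \<longleftrightarrow> s \<le> t \<and> (i, j) \<in> level_graph X ^^ nat (t - s)"
proof
  assume "((i, s), (j, t)) \<in> (level_cover X)\<^sup>*"
  then show "s \<le> t \<and> (i, j) \<in> level_graph X ^^ nat (t - s)"
  proof (induction rule: rtrancl_induct2)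
    case (step j t k u)
    then have u: "u = t + 1" and jk: "(j, k) \<in> level_graph X" by (auto simp: level_cover_def level_graph_def)
    have "nat (u - s) = Suc (nat (t - s))" using step.IH u by (simp add: Suc_nat_eq_nat_zadd1 algebra_simps)
    then show ?case using step.IH relpow_Suc_I[OF _ jk] u by simp
  qed simp
next
  have "((i, s), (j, s + int n)) \<in> (level_cover X)\<^sup>*" if "(i, j) \<in> level_graph X ^^ n" for n
    using that
  proof (induction n arbitrary: j)
    case (Suc n)
    then obtain k where k: "(i, k) \<in> level_graph X ^^ n" "(k, j) \<in> level_graph X" by auto
    then have "((k, s + int n), (j, s + int (Suc n))) \<in> level_cover X"
      by (auto simp: level_cover_def level_graph_def)
    with Suc.IH[OF k(1)] show ?case by (rule rtrancl_into_rtrancl)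
  qed auto
  then show "((i, s), (j, t)) \<in> (level_cover X)\<^sup>*"
    if "s \<le> t \<and> (i, j) \<in> level_graph X ^^ nat (t - s)"
    using that by fastforce
qed

lemma level_le_iff:
  "((i, s), (j, t)) \<in> level_le X \<longleftrightarrow> i < dim_row X \<and> j < dim_row X \<and>
     s \<le> t \<and> (i, j) \<in> level_graph X ^^ nat (t - s)"
  by (auto simp: level_le_def level_carrier_def level_cover_rtrancl_iff)

text \<open>The value 0 for incomparable pairs lets the recursion sum over all indices instead of
  over an interval.\<close>

definition level_index :: "int mat \<Rightarrow> nat \<times> int \<Rightarrow> nat \<times> int \<Rightarrow> ab ncfps" where
  "level_index X x y = (if (x, y) \<in> level_le X
     then ab_index (poset_interval (level_le X) x y) (level_le X) snd else 0)"

text \<open>The second element of a longer chain is some \<open>(l, s + 1 + int m)\<close> with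
  \<open>m < n\<close>; its rank distance from the bottom is \<open>m + 1\<close>, hence the
  exponent \<open>m\<close>.\<close>

lemma level_index_rec:
  assumes ij: "i < dim_row X" "j < dim_row X"
  shows "level_index X (i, s) (j, s + 1 + int n) =
    of_bool ((i, j) \<in> level_graph X ^^ Suc n) * (va - vb) ^ n +
    (\<Sum>m<n. \<Sum>l<dim_row X. of_bool ((i, l) \<in> level_graph X ^^ Suc m) * (va - vb) ^ m * vb *
       level_index X (l, s + 1 + int m) (j, s + 1 + int n))"
    (is "?lhs = _ + ?sum")
proof (cases "((i, s), (j, s + 1 + int n)) \<in> level_le X")
  let ?x = "(i, s)" and ?y = "(j, s + 1 + int n)" and ?R = "level_le X" and ?G = "level_graph X"
  let ?f = "\<lambda>(m, l). of_bool ((i, l) \<in> ?G ^^ Suc m) * (va - vb) ^ m * vb * level_index X (l, s + 1 + int m) ?y"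
  have sum_eq: "?sum = sum ?f ({..<n} \<times> {..<dim_row X})"
    by (simp add: sum.cartesian_product)
  have po: "antisym ?R" "trans ?R" "\<And>z. fst z < dim_row X \<Longrightarrow> (z, z) \<in> ?R"
    using partial_order_on_level_le[of X]
    by (auto simp: partial_order_on_def preorder_on_def level_le_iff)
  have le1: "(?x, (l, s + 1 + int m)) \<in> ?R \<longleftrightarrow> (i, l) \<in> ?G ^^ Suc m" if "l < dim_row X" for l m
    using that ij by (simp add: level_le_iff nat_add_distrib del: relpow.simps)
  {
    case True
    let ?A = "{(m, l). m < n \<and> l < dim_row X \<and> (i, l) \<in> ?G ^^ Suc m \<and> ((l, s + 1 + int m), ?y) \<in> ?R}"
    have I: "poset_interval ?R ?x ?y - {?x, ?y} = (\<lambda>(m, l). (l, s + 1 + int m)) ` ?A" (is "?I = ?g ` _")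
    proof (intro equalityI subsetI)
      fix z assume z: "z \<in> ?I"
      obtain l t where lt: "z = (l, t)" by (cases z)
      from z lt have "(?x, z) \<in> ?R" "(z, ?y) \<in> ?R" "z \<noteq> ?x" "z \<noteq> ?y" by (auto simp: poset_interval_def)
      then have "s < t" "t < s + 1 + int n" and l: "l < dim_row X"
        using level_cover_rtrancl_snd[of ?x z X] level_cover_rtrancl_snd[of z ?y X]
        by (auto simp: lt level_le_def level_carrier_def)
      then have "(nat (t - s - 1), l) \<in> ?A" "z = ?g (nat (t - s - 1), l)"
        using le1[OF l, of "nat (t - s - 1)"] \<open>(?x, z) \<in> ?R\<close> \<open>(z, ?y) \<in> ?R\<close> by (auto simp: lt)
      then show "z \<in> ?g ` ?A" by blast
    qed (auto simp: poset_interval_def le1 simp del: relpow.simps)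
    have "?lhs = ab_index (poset_interval ?R ?x ?y) ?R snd"
      using True by (simp add: level_index_def)
    also have "\<dots> = (va - vb) ^ nat (snd ?y - snd ?x - 1) +
       (\<Sum>z\<in>?I. (va - vb) ^ nat (snd z - snd ?x - 1) * vb * ab_index (poset_interval ?R z ?y) ?R snd)"
      using True po ij
      by (intro ab_index_interval_rec finite_level_interval)
        (auto simp: poset_interval_def level_le_def level_carrier_def)
    also have "(\<Sum>z\<in>?I. (va - vb) ^ nat (snd z - snd ?x - 1) * vb * ab_index (poset_interval ?R z ?y) ?R snd)
      = sum ?f ?A"
      unfolding I by (subst sum.reindex) (auto simp: inj_on_def level_index_def simp del: relpow.simps intro!: sum.cong)
    also have "\<dots> = ?sum"
      unfolding sum_eq
    proof (rule sum.mono_neutral_left)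
      have "level_index X z ?y = 0" if "(z, ?y) \<notin> ?R" for z
        using that by (simp add: level_index_def)
      then have "?f (m, l) = 0" if "m < n" "l < dim_row X" "(m, l) \<notin> ?A" for m l
        using that by (cases "(i, l) \<in> ?G ^^ Suc m") (simp_all del: relpow.simps)
      then show "\<forall>p\<in>{..<n} \<times> {..<dim_row X} - ?A. ?f p = 0"
        by blast
    qed auto
    finally show ?thesis
      using True ij by (simp add: level_le_iff nat_add_distrib del: relpow.simps)
  next
    case False
    \<comment> \<open>If no factor vanished, transitivity through the middle element would make the
      endpoints comparable.\<close>
    have "?f (m, l) = 0" if "l < dim_row X" for m l
      using False that le1[of l m] po(2) by (auto simp: level_index_def simp del: relpow.simps dest: transD)
    then have "?sum = 0"
      unfolding sum_eq by (intro sum.neutral) auto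
    then show ?thesis
      using False ij by (simp add: level_index_def level_le_iff nat_add_distrib del: relpow.simps)
  }
qed

text \<open>The coefficients in \<open>level_index_rec\<close> are free of \<open>s\<close>, so
  strong induction on the rank gap suffices.\<close>

lemma level_index_translate:
  assumes "i < dim_row X" "j < dim_row X"
  shows "level_index X (i, s) (j, s + 1 + int n) = level_index X (i, 0) (j, 1 + int n)"
  using assms(1)
proof (induction n arbitrary: i s rule: less_induct)
  case (less n)
  have IH: "level_index X (l, s + 1 + int m) (j, s + 1 + int n) = level_index X (l, 0) (j, 1 + int (n - Suc m))"
    if "m < n" "l < dim_row X" for s l m
    using less.IH[of "n - Suc m" l "s + 1 + int m"] that by (simp add: of_nat_diff algebra_simps)
  show ?case
    using IH[of _ _ s] IH[of _ _ 0] level_index_rec[OF less.prems assms(2), of s n]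
      level_index_rec[OF less.prems assms(2), of 0 n] by simp
qed

lemma nc_homogeneous_level_index:
  assumes "i < dim_row X" "j < dim_row X"
  shows "nc_homogeneous n (level_index X (i, 0) (j, 1 + int n))"
  using assms(1)
proof (induction n arbitrary: i rule: less_induct)
  case (less n)
  have e: "nc_homogeneous m (of_bool P * (va - vb) ^ m)" for m P
    by (intro nc_homogeneous_of_bool nc_homogeneous_power nc_homogeneous_va_minus_vb)
  have "nc_homogeneous n (of_bool Q * (va - vb) ^ m * vb * level_index X (l, 1 + int m) (j, 1 + int n))"
    if "m < n" "l < dim_row X" for m l Q
  proof -
    have "level_index X (l, 1 + int m) (j, 1 + int n) = level_index X (l, 0) (j, 1 + int (n - Suc m))"
      using level_index_translate[OF that(2) assms(2), of "1 + int m" "n - Suc m"] that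
      by (simp add: of_nat_diff)
    \<comment> \<open>The degrees come from the power, from \<open>vb\<close> and from the remaining
      interval, and add up to \<open>n\<close>.\<close>
    then have "nc_homogeneous (m + 1 + (n - Suc m))
        (of_bool Q * (va - vb) ^ m * vb * level_index X (l, 1 + int m) (j, 1 + int n))"
      using less.IH[of "n - Suc m" l] that by (simp only:) (intro nc_homogeneous_mult nc_homogeneous_vb e, simp)
    then show ?thesis using that by simp
  qed
  then show ?case
    unfolding level_index_rec[OF less.prems assms(2), of 0 n, simplified add_0_left]
    by (intro nc_homogeneous_add nc_homogeneous_sum e) auto
qed

text \<open>The contribution to \<open>level_Psi X i j\<close> of the chains without interior elements.\<close>

definition level_K :: "int mat \<Rightarrow> nat \<Rightarrow> nat \<Rightarrow> ab ncfps" where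
  "level_K X i j = nc_graded_sum (\<lambda>n. of_bool ((i, j) \<in> level_graph X ^^ Suc n) * (va - vb) ^ n)"

lemma level_Psi_graded:
  assumes "i < dim_row X" "j < dim_row X"
  shows "level_Psi X i j = nc_graded_sum (\<lambda>n. level_index X (i, 0) (j, 1 + int n))"
proof -
  let ?F = "\<lambda>k. if k \<ge> 1 then level_index X (i, 0) (j, int k) else 0"
  have "level_Psi X i j = nc_suminf ?F"
    unfolding level_Psi_def by (intro arg_cong[of _ _ nc_suminf] ext) (simp add: level_index_def)
  also have "\<dots> = nc_graded_sum (\<lambda>n. ?F (Suc n))"
    using nc_homogeneous_level_index[OF assms] by (intro nc_suminf_eq_graded_sum) simp_all
  finally show ?thesis by simp
qed

text \<open>Summed over \<open>n\<close>, the convolution in \<open>level_index_rec\<close> becomes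
  a product of series.\<close>

lemma level_Psi_rec:
  assumes "i < dim_row X" "j < dim_row X"
  shows "level_Psi X i j = level_K X i j + (\<Sum>l<dim_row X. level_K X i l * vb * level_Psi X l j)"
proof -
  let ?G = "level_graph X" and ?e = "va - vb"
  have hom: "nc_homogeneous n (of_bool P * ?e ^ n)" for n P
    by (intro nc_homogeneous_of_bool nc_homogeneous_power nc_homogeneous_va_minus_vb)
  have "level_K X i l * vb * level_Psi X l j = nc_graded_sum (\<lambda>n. \<Sum>m<n.
      of_bool ((i, l) \<in> ?G ^^ Suc m) * ?e ^ m * vb * level_index X (l, 0 + 1 + int m) (j, 0 + 1 + int n))"
    (is "_ = nc_graded_sum ?s") if l: "l < dim_row X" for l
  proof -
    let ?P = "\<lambda>n. level_index X (l, 0) (j, 1 + int n)"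
    have P: "nc_homogeneous n (?P n)" for n using l assms(2) by (rule nc_homogeneous_level_index)
    \<comment> \<open>The factor \<open>vb\<close> raises degrees by 1; the value 0 at
      \<open>n = 0\<close> cancels the term \<open>m = n\<close> of the Cauchy product, leaving
      \<open>m < n\<close> as in the recursion.\<close>
    let ?Q = "\<lambda>n. if n = 0 then 0 else vb * ?P (n - 1)"
    have Q: "nc_homogeneous n (?Q n)" for n
      using nc_homogeneous_mult[OF nc_homogeneous_vb P, of "n - 1"] by (cases n) (simp_all add: nc_homogeneous_0)
    have "level_K X i l * vb * level_Psi X l j = level_K X i l * nc_graded_sum ?Q"
      unfolding level_Psi_graded[OF l assms(2)]
      by (simp only: mult.assoc nc_graded_sum_mult_left[OF nc_homogeneous_vb P])
    also have "\<dots> = nc_graded_sum (\<lambda>n. \<Sum>m\<le>n. of_bool ((i, l) \<in> ?G ^^ Suc m) * ?e ^ m * ?Q (n - m))"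
      unfolding level_K_def by (rule nc_graded_sum_mult[OF hom Q])
    also have "\<dots> = nc_graded_sum ?s"
    proof (intro arg_cong[of _ _ nc_graded_sum] ext)
      fix n
      have "level_index X (l, 0 + 1 + int m) (j, 0 + 1 + int n) = ?P (n - m - 1)" if "m < n" for m
        using level_index_translate[OF l assms(2), of "1 + int m" "n - m - 1"] that by (simp add: of_nat_diff)
      then show "(\<Sum>m\<le>n. of_bool ((i, l) \<in> ?G ^^ Suc m) * ?e ^ m * ?Q (n - m)) = ?s n"
        by (simp add: lessThan_Suc_atMost[symmetric] mult.assoc)
    qed
    finally show ?thesis .
  qed
  then have "(\<Sum>l<dim_row X. level_K X i l * vb * level_Psi X l j) = nc_graded_sum (\<lambda>n. \<Sum>m<n. \<Sum>l<dim_row X.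
      of_bool ((i, l) \<in> ?G ^^ Suc m) * ?e ^ m * vb * level_index X (l, 0 + 1 + int m) (j, 0 + 1 + int n))"
    by (subst sum.swap) (simp add: nc_graded_sum_sum)
  then show ?thesis
    unfolding level_Psi_graded[OF assms]
    using level_index_rec[OF assms, of 0] by (simp add: level_K_def nc_graded_sum_add del: relpow.simps)
qed

section \<open>Paths in the graph of M\<close>

text \<open>Support of \<open>matrix_M r\<close> in global indices; the middle case is the two-entry
  band of \<open>block_B\<close>.\<close>

definition M_edge :: "nat \<Rightarrow> nat \<Rightarrow> nat \<Rightarrow> bool" where
  "M_edge r i j \<longleftrightarrow> (if i = 0 then j \<le> r + 1
     else if i \<le> r then j = r + i \<or> j = r + i + 1 else j \<le> r \<or> j = 2 * r + 1)"

text \<open>Support of the square. Rows 1 to \<open>r\<close> step only to indices above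
  \<open>r\<close>, which all have the same successors; every other row is full.\<close>

definition M_edge2 :: "nat \<Rightarrow> nat \<Rightarrow> nat \<Rightarrow> bool" where
  "M_edge2 r i j \<longleftrightarrow> (1 \<le> i \<and> i \<le> r \<longrightarrow> j \<le> r \<or> j = 2 * r + 1)"

lemma dim_matrix_M [simp]: "dim_row (matrix_M r) = 2 * r + 2" "dim_col (matrix_M r) = 2 * r + 2"
  by (simp_all add: matrix_M_def block_A_def block_A_dagger_def)

lemma level_graph_matrix_M:
  "level_graph (matrix_M r) = {(i, j). i < 2 * r + 2 \<and> j < 2 * r + 2 \<and> M_edge r i j}"
proof -
  have "matrix_M r $$ (i, j) = of_bool (M_edge r i j)" if "i < 2 * r + 2" "j < 2 * r + 2" for i j
    using that unfolding matrix_M_def M_edge_def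
    by (auto simp: block_A_def block_B_def block_J_def block_A_dagger_def)
  then show ?thesis by (auto simp: level_graph_def)
qed

lemma matrix_M_relpow_2:
  "level_graph (matrix_M r) ^^ 2 = {(i, j). i < 2 * r + 2 \<and> j < 2 * r + 2 \<and> M_edge2 r i j}"
    (is "?G ^^ 2 = ?G2")
proof -
  have "?G O ?G = ?G2"
  proof (intro equalityI subrelI)
    fix i j assume "(i, j) \<in> ?G O ?G"
    then show "(i, j) \<in> ?G2" by (auto simp: level_graph_matrix_M M_edge_def M_edge2_def split: if_splits)
  next
    fix i j assume ij: "(i, j) \<in> ?G2"
    \<comment> \<open>Rows 1 to \<open>r\<close> go through their diagonal entry in
      \<open>block_B\<close>. Other rows reach every index up to \<open>r\<close>, so
      \<open>l\<close> may be any predecessor of \<open>j\<close> there: 0, or the one on the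
      diagonal of \<open>block_B\<close>.\<close>
    define l where "l = (if 1 \<le> i \<and> i \<le> r then r + i + 1 else if j \<le> r then 0 else j - (r + 1))"
    have "(i, l) \<in> ?G" "(l, j) \<in> ?G"
      using ij by (auto simp: l_def level_graph_matrix_M M_edge_def M_edge2_def)
    then show "(i, j) \<in> ?G O ?G" by blast
  qed
  then show ?thesis by (simp add: numeral_2_eq_2)
qed

text \<open>Two steps lead from anywhere to any \<open>l \<le> r\<close>, and every \<open>j\<close>
  has a predecessor \<open>l \<le> r\<close>.\<close>

lemma matrix_M_relpow_ge_3:
  "level_graph (matrix_M r) ^^ (n + 3) = {..<2 * r + 2} \<times> {..<2 * r + 2}"
proof (induction n)
  have step: "(\<exists>l\<le>r. (l, j) \<in> level_graph (matrix_M r))" if "j < 2 * r + 2" for j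
    using that by (intro exI[of _ "if j \<le> r then 0 else j - (r + 1)"]) (auto simp: level_graph_matrix_M M_edge_def)
  have sub: "level_graph (matrix_M r) \<subseteq> {..<2 * r + 2} \<times> {..<2 * r + 2}"
    by (auto simp: level_graph_matrix_M)
  {
    case 0
    have *: "level_graph (matrix_M r) ^^ (0 + 3) = level_graph (matrix_M r) ^^ 2 O level_graph (matrix_M r)"
      by (simp add: numeral_3_eq_3 numeral_2_eq_2)
    show ?case
    proof (intro equalityI subrelI)
      fix i j assume "(i, j) \<in> {..<2 * r + 2} \<times> {..<2 * r + 2}"
      moreover from this obtain l where "l \<le> r" "(l, j) \<in> level_graph (matrix_M r)" using step by blast
      ultimately show "(i, j) \<in> level_graph (matrix_M r) ^^ (0 + 3)"
        unfolding * by (intro relcompI[of i l]) (auto simp: matrix_M_relpow_2 M_edge2_def)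
    qed (unfold *, use sub in \<open>auto simp: matrix_M_relpow_2\<close>)
  next
    case (Suc n)
    have *: "level_graph (matrix_M r) ^^ (Suc n + 3) = level_graph (matrix_M r) ^^ (n + 3) O level_graph (matrix_M r)"
      by (simp only: add_Suc relpow.simps)
    show ?case
    proof (intro equalityI subrelI)
      fix i j assume "(i, j) \<in> {..<2 * r + 2} \<times> {..<2 * r + 2}"
      moreover from this obtain l where "l \<le> r" "(l, j) \<in> level_graph (matrix_M r)" using step by blast
      ultimately show "(i, j) \<in> level_graph (matrix_M r) ^^ (Suc n + 3)"
        unfolding * Suc by (intro relcompI[of i l]) auto
    qed (unfold * Suc, use sub in auto)
  }
qed

text \<open>Paths of length at least 3 join any two indices, so multiplying \<open>level_K\<close> by \<open>1 - (a - b)\<close>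
  leaves a polynomial of degree 2.\<close>

definition M_coeff :: "nat \<Rightarrow> nat \<Rightarrow> nat \<Rightarrow> ab ncfps" where
  "M_coeff r i j = of_bool (M_edge r i j) + (of_bool (M_edge2 r i j) - of_bool (M_edge r i j)) * (va - vb)
     + (1 - of_bool (M_edge2 r i j)) * (va - vb) ^ 2"

lemma level_K_matrix_M:
  assumes "i < 2 * r + 2" "j < 2 * r + 2"
  shows "(1 - (va - vb)) * level_K (matrix_M r) i j = M_coeff r i j"
proof -
  let ?e = "va - vb :: ab ncfps" and ?G = "level_graph (matrix_M r)"
  let ?m = "of_bool (M_edge r i j) :: ab ncfps" and ?d = "of_bool (M_edge2 r i j) :: ab ncfps"
  let ?f = "\<lambda>n. of_bool ((i, j) \<in> ?G ^^ Suc n) * ?e ^ n"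
  have hom: "nc_homogeneous n (of_bool P * ?e ^ n)" for n P
    by (intro nc_homogeneous_of_bool nc_homogeneous_power nc_homogeneous_va_minus_vb)
  \<comment> \<open>In degree \<open>n\<close> the difference compares paths of lengths
    \<open>n + 1\<close> and \<open>n\<close>; from \<open>n = 3\<close> on both exist and it
    vanishes.\<close>
  have *: "?f n - (if n = 0 then 0 else ?e * ?f (n - 1)) = (if n = 0 then ?m else 0)
      + (if n = 1 then (?d - ?m) * ?e else 0) + (if n = 2 then (1 - ?d) * ?e ^ 2 else 0)" for n
  proof -
    consider "n = 0" | "n = 1" | "n = 2" | k where "n = k + 3"
      using le_Suc_ex[of 3 n] by (cases "n < 3") (auto simp: less_Suc_eq numeral_3_eq_3 numeral_2_eq_2)
    then show ?thesis
    proof cases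
      case 1
      then show ?thesis using assms by (simp add: level_graph_matrix_M)
    next
      case 2
      have "?G ^^ Suc 1 = ?G ^^ 2" by (simp only: Suc_1)
      then show ?thesis using assms 2
        by (simp add: matrix_M_relpow_2 del: relpow.simps) (simp add: level_graph_matrix_M algebra_simps)
    next
      case 3
      have "?G ^^ Suc 2 = ?G ^^ (0 + 3)" "?G ^^ Suc (2 - 1) = ?G ^^ 2" by (simp_all only: numeral_3_eq_3 numeral_2_eq_2, simp_all)
      then show ?thesis using assms 3
        by (simp add: matrix_M_relpow_2 matrix_M_relpow_ge_3[of 0, simplified] power2_eq_square algebra_simps del: relpow.simps)
    next
      case 4
      have pow: "?e * ?e ^ (n - 1) = ?e ^ n" using 4 by (subst (2) power_eq_if) simp
      have n: "Suc n = Suc k + 3" "Suc (n - 1) = k + 3" and "n \<ge> 3" using 4 by simp_all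
      show ?thesis using assms \<open>n \<ge> 3\<close>
        by (simp only: n matrix_M_relpow_ge_3) (simp add: pow del: One_nat_def)
    qed
  qed
  have "(1 - ?e) * level_K (matrix_M r) i j = level_K (matrix_M r) i j - ?e * level_K (matrix_M r) i j"
    by (simp only: left_diff_distrib mult_1_left)
  also have "\<dots> = nc_graded_sum (\<lambda>n. ?f n - (if n = 0 then 0 else ?e * ?f (n - 1)))"
    unfolding level_K_def
    by (simp only: nc_graded_sum_diff nc_graded_sum_mult_left[OF nc_homogeneous_va_minus_vb hom])
  also have "\<dots> = ?m + (?d - ?m) * ?e + (1 - ?d) * ?e ^ 2"
    unfolding * nc_graded_sum_add
    using nc_graded_sum_single[of 0 ?m] nc_graded_sum_single[of 1 "(?d - ?m) * ?e"]
      nc_graded_sum_single[of 2 "(1 - ?d) * ?e ^ 2"] hom[of 0 "M_edge r i j"]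
      hom[of 2 "\<not> M_edge2 r i j"] nc_homogeneous_diff[OF hom[of 1 "M_edge2 r i j"] hom[of 1 "M_edge r i j"]]
    by (simp add: left_diff_distrib of_bool_not_iff)
  also have "\<dots> = M_coeff r i j"
    by (simp only: M_coeff_def)
  finally show ?thesis .
qed

section \<open>The polynomial linear system for the columns of the series matrix\<close>

lemma level_Psi_matrix_M_rec:
  assumes "i < 2 * r + 2" "j < 2 * r + 2"
  shows "(1 - (va - vb)) * level_Psi (matrix_M r) i j =
    M_coeff r i j + (\<Sum>l<2 * r + 2. M_coeff r i l * vb * level_Psi (matrix_M r) l j)"
proof -
  let ?M = "matrix_M r"
  have "(1 - (va - vb)) * level_Psi ?M i j = (1 - (va - vb)) * level_K ?M i j +
      (\<Sum>l<2 * r + 2. (1 - (va - vb)) * level_K ?M i l * vb * level_Psi ?M l j)"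
    using level_Psi_rec[of i ?M j] assms by (simp add: distrib_left sum_distrib_left mult.assoc)
  then show ?thesis using assms by (simp add: level_K_matrix_M)
qed

text \<open>Moving \<open>(va - vb) * G i\<close> to the right gives a system with matrix
  \<open>?X\<close>, free of constant terms, for one column \<open>j\<close> at a time.\<close>

lemma level_Psi_matrix_M_unique:
  assumes G: "\<And>i. i < 2 * r + 2 \<Longrightarrow> (1 - (va - vb)) * G i = M_coeff r i j + (\<Sum>l<2 * r + 2. M_coeff r i l * vb * G l)"
    and "i < 2 * r + 2" "j < 2 * r + 2"
  shows "level_Psi (matrix_M r) i j = G i"
proof -
  let ?X = "\<lambda>i l. (if l = i then va - vb else 0) + M_coeff r i l * vb"
  have X: "nc_coeff (?X i l) [] = 0" for i l
    using nc_homogeneous_vb nc_homogeneous_va_minus_vb by (simp add: nc_homogeneous_def nc_coeff_mult)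
  have rec: "F i = M_coeff r i j + (\<Sum>l\<in>{..<2 * r + 2}. ?X i l * F l)"
    if F: "(1 - (va - vb)) * F i = M_coeff r i j + (\<Sum>l<2 * r + 2. M_coeff r i l * vb * F l)"
      and i: "i \<in> {..<2 * r + 2}" for F i
  proof -
    have "(\<Sum>l\<in>{..<2 * r + 2}. ?X i l * F l) =
        (\<Sum>l\<in>{..<2 * r + 2}. if l = i then (va - vb) * F i else 0) + (\<Sum>l<2 * r + 2. M_coeff r i l * vb * F l)"
      by (simp only: sum.distrib[symmetric] distrib_right) (intro sum.cong, auto)
    also have "(\<Sum>l\<in>{..<2 * r + 2}. if l = i then (va - vb) * F i else 0) = (va - vb) * F i"
      using i by simp
    finally show ?thesis using F by (simp only: left_diff_distrib mult_1_left) (simp add: algebra_simps)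
  qed
  show ?thesis
  proof (rule ncfps_linear_system_unique[where X = ?X and A = "{..<2 * r + 2}" and L = "\<lambda>i. M_coeff r i j"
        and F = "\<lambda>i. level_Psi (matrix_M r) i j", OF X])
    show "level_Psi (matrix_M r) i j = M_coeff r i j + (\<Sum>l\<in>{..<2 * r + 2}. ?X i l * level_Psi (matrix_M r) l j)"
      if "i \<in> {..<2 * r + 2}" for i
      using that assms(3) by (intro rec level_Psi_matrix_M_rec) simp_all
    show "G i = M_coeff r i j + (\<Sum>l\<in>{..<2 * r + 2}. ?X i l * G l)" if "i \<in> {..<2 * r + 2}" for i
      using that by (intro rec G) simp_all
  qed (use assms(2) in simp)
qed

section \<open>The closed form solves the linear system\<close>

text \<open>The recursion in a row where the entry of \<open>p\<close> is 1, respectively \<open>c\<close>. The bracket after \<open>L\<close>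
  collects first the summands \<open>l \<le> r\<close>, then the summands \<open>l > r\<close>.\<close>

lemma row_identity_one:
  fixes a b \<rho> y P L C h :: "'a :: ring_1"
  assumes r: "\<rho> * a = a * \<rho>" "\<rho> * b = b * \<rho>"
    and y: "(1 - (a + b) - \<rho> * (a * b + b * a)) * y = P"
    and P: "P = L - (1 - (a - b)) * C + b * h"
  shows "(1 - (a - b)) * (y + C) =
    L + (b * ((1 + \<rho> * (a + b)) * y + h) + (b * y + \<rho> * (a - b) * b * y))"
proof -
  have r': "\<rho> * (a * x) = a * (\<rho> * x)" "\<rho> * (b * x) = b * (\<rho> * x)" for x
    using r by (metis mult.assoc)+
  \<comment> \<open>With \<open>e = a - b\<close> and \<open>c = a + b\<close>, this rests on
    \<open>e b + b c = a b + b a\<close>.\<close>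
  have "(1 - (a - b)) * y - b * ((1 + \<rho> * (a + b)) * y) - b * y - \<rho> * (a - b) * b * y
     = (1 - (a + b) - \<rho> * (a * b + b * a)) * y"
    by (simp add: algebra_simps r r')
  then show ?thesis unfolding y P by (simp add: algebra_simps)
qed

lemma row_identity_c:
  fixes a b \<rho> y P L C h :: "'a :: ring_1"
  assumes r: "\<rho> * a = a * \<rho>" "\<rho> * b = b * \<rho>"
    and y: "(1 - (a + b) - \<rho> * (a * b + b * a)) * y = P"
    and P: "(a - b) * P = L - (1 - (a - b)) * C + (a - b) * b * h"
  shows "(1 - (a - b)) * ((a + b) * y + C) = L + ((a - b) * b * ((1 + \<rho> * (a + b)) * y + h) +
     ((1 - (a - b)) + (1 - (a - b)) + ((a - b) - (a - b)^2) + (\<rho> + 1) * (a - b)^2) * (b * y))"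
proof -
  have r': "\<rho> * (a * x) = a * (\<rho> * x)" "\<rho> * (b * x) = b * (\<rho> * x)" for x
    using r by (metis mult.assoc)+
  \<comment> \<open>Besides \<open>e b + b c = a b + b a\<close> this uses
    \<open>c - 2 b = e\<close>, which yields the left factor \<open>e = a - b\<close>.\<close>
  have "(1 - (a - b)) * ((a + b) * y) - (a - b) * b * ((1 + \<rho> * (a + b)) * y)
     - ((1 - (a - b)) + (1 - (a - b)) + ((a - b) - (a - b)^2) + (\<rho> + 1) * (a - b)^2) * (b * y)
     = (a - b) * ((1 - (a + b) - \<rho> * (a * b + b * a)) * y)"
    by (simp add: algebra_simps r r' power2_eq_square)
  then show ?thesis unfolding y P by (simp add: algebra_simps)
qed

section \<open>Entries and column sums of the claimed solution\<close>

definition C_entry :: "nat \<Rightarrow> nat \<Rightarrow> nat \<Rightarrow> ab ncfps" where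
  "C_entry r i j = (if i \<le> r \<and> r < j then of_bool (M_edge r i j) - of_bool (i = 0 \<and> j = 2 * r + 1) else 0)"

text \<open>Columns of \<open>block_B\<close> sum to 2 except the last, which sums to 1; the corner
  entry of \<open>block_H\<close> lowers that to 0. So 2 occurs exactly where the row vector has
  entry \<open>vc\<close>.\<close>

lemma sum_C_entry:
  assumes "j < 2 * r + 2"
  shows "(\<Sum>l\<le>r. C_entry r l j) = (if r < j \<and> j \<le> 2 * r then 2 else 0)"
proof (cases "r < j")
  case True
  have "(\<Sum>l\<le>r. C_entry r l j) = (\<Sum>l\<le>r. (if l = j - (r + 1) then 1 else 0) + (if l = j - r then 1 else 0)
      - (if l = 0 then of_bool (j = 2 * r + 1) else 0))"
    using True assms by (intro sum.cong) (auto simp: C_entry_def M_edge_def)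
  also have "\<dots> = 1 + of_bool (j - r \<le> r) - of_bool (j = 2 * r + 1)"
    using True assms by (auto simp: sum.distrib sum_subtractf)
  finally show ?thesis using True assms by auto
qed (simp add: C_entry_def)

definition psi_entry :: "nat \<Rightarrow> nat \<Rightarrow> nat \<Rightarrow> ab ncfps" where
  "psi_entry r i j = (if 1 \<le> i \<and> i \<le> r then vc else 1) * phi r * (if r + 1 \<le> j \<and> j \<le> 2 * r then vc else 1)
     + C_entry r i j"

lemma psi_entry_rec:
  assumes i: "i < 2 * r + 2" and j: "j < 2 * r + 2"
  shows "(1 - (va - vb)) * psi_entry r i j = M_coeff r i j + (\<Sum>l<2 * r + 2. M_coeff r i l * vb * psi_entry r l j)"
proof -
  let ?e = "va - vb :: ab ncfps" and ?\<rho> = "of_nat r :: ab ncfps"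
  define P where "P = (if r + 1 \<le> j \<and> j \<le> 2 * r then vc else 1)"
  define y where "y = phi r * P"
  define h :: "ab ncfps" where "h = (if r < j \<and> j \<le> 2 * r then 2 else 0)"
  have psi_eq: "psi_entry r l j = (if 1 \<le> l \<and> l \<le> r then vc * y else y) + C_entry r l j" for l
    by (simp add: psi_entry_def y_def P_def mult.assoc)
  have \<rho>: "?\<rho> * x = x * ?\<rho>" for x by (rule mult_of_nat_commute)
  have "(1 - (vc + of_nat r * vd)) * phi r = 1"
    unfolding phi_def
    by (rule nc_geom_inverse) (simp add: vc_def vd_def va_def vb_def nc_var_def nc_coeff_mult)
  then have y: "(1 - (va + vb) - ?\<rho> * (va * vb + vb * va)) * y = P"
    by (simp add: y_def vc_def vd_def diff_diff_eq mult.assoc[symmetric])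
  have "(\<Sum>l\<le>r. psi_entry r l j) = (\<Sum>l\<le>r. if 1 \<le> l \<and> l \<le> r then vc * y else y) + h"
    by (simp only: psi_eq sum.distrib sum_C_entry[OF j] h_def)
  also have "(\<Sum>l\<le>r. if 1 \<le> l \<and> l \<le> r then vc * y else y) = y + (\<Sum>l\<in>{1..r}. vc * y)"
    unfolding atMost_atLeast0 by (subst sum.atLeast_Suc_atMost) (auto intro!: sum.cong)
  also have "\<dots> = (1 + ?\<rho> * (va + vb)) * y"
    by (simp add: vc_def distrib_right mult.assoc)
  finally have first: "(\<Sum>l\<le>r. psi_entry r l j) = (1 + ?\<rho> * (va + vb)) * y + h" .
  \<comment> \<open>For \<open>l > r\<close> the entry of \<open>vec_p\<close> is 1 and that of C is
    0, so \<open>psi_entry r l j = y\<close> and only the row sum of \<open>M_coeff\<close>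
    matters.\<close>
  have "{..<2 * r + 2} = {..r} \<union> {r + 1..2 * r + 1}" by auto
  then have "(\<Sum>l<2 * r + 2. M_coeff r i l * vb * psi_entry r l j) =
      (\<Sum>l\<le>r. M_coeff r i l * vb * psi_entry r l j) + (\<Sum>l=r+1..2*r+1. M_coeff r i l * vb * psi_entry r l j)"
    by (simp only:) (intro sum.union_disjoint, auto)
  also have "(\<Sum>l=r+1..2*r+1. M_coeff r i l * vb * psi_entry r l j) = (\<Sum>l=r+1..2*r+1. M_coeff r i l) * (vb * y)"
    by (simp only: sum_distrib_right) (intro sum.cong, auto simp: psi_eq C_entry_def mult.assoc)
  finally have split: "(\<Sum>l<2 * r + 2. M_coeff r i l * vb * psi_entry r l j) =
      (\<Sum>l\<le>r. M_coeff r i l * vb * psi_entry r l j) + (\<Sum>l=r+1..2*r+1. M_coeff r i l) * (vb * y)" .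
  show ?thesis
  proof (cases "1 \<le> i \<and> i \<le> r")
    case False
    \<comment> \<open>\<open>k\<close> is the only successor of \<open>i\<close> above
      \<open>r\<close>: there \<open>M_coeff\<close> is 1, at the other indices above
      \<open>r\<close> it is \<open>?e\<close>.\<close>
    define k where "k = (if i = 0 then r + 1 else 2 * r + 1)"
    have "(\<Sum>l\<le>r. M_coeff r i l * vb * psi_entry r l j) = vb * (\<Sum>l\<le>r. psi_entry r l j)"
      unfolding sum_distrib_left using False by (intro sum.cong) (auto simp: M_coeff_def M_edge_def M_edge2_def)
    moreover have "(\<Sum>l=r+1..2*r+1. M_coeff r i l) = 1 + ?\<rho> * ?e"
    proof -
      have "(\<Sum>l=r+1..2*r+1. M_coeff r i l) = (\<Sum>l=r+1..2*r+1. (if l = k then 1 - ?e else 0) + ?e)"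
        using False by (intro sum.cong) (auto simp: k_def M_coeff_def M_edge_def M_edge2_def)
      also have "\<dots> = (1 - ?e) + (?\<rho> + 1) * ?e"
        by (simp add: sum.distrib k_def add.commute[of 1])
      finally show ?thesis by (simp add: distrib_right)
    qed
    ultimately have sum: "(\<Sum>l<2 * r + 2. M_coeff r i l * vb * psi_entry r l j) =
        vb * ((1 + ?\<rho> * (va + vb)) * y + h) + (vb * y + ?\<rho> * ?e * vb * y)"
      unfolding split first by (simp add: distrib_right mult.assoc)
    \<comment> \<open>Here the shape of C enters; the columns with \<open>P = vc\<close> use
      \<open>vc = ?e + 2 * vb\<close>.\<close>
    have P: "P = M_coeff r i j - (1 - ?e) * C_entry r i j + vb * h"
      using False j by (auto simp: P_def h_def M_coeff_def C_entry_def M_edge_def M_edge2_def vc_def mult_2_right algebra_simps)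
    have psi: "psi_entry r i j = y + C_entry r i j"
      using False by (auto simp: psi_eq)
    show ?thesis
      unfolding sum psi by (rule row_identity_one[OF \<rho> \<rho> y P])
  next
    case True
    have "(\<Sum>l\<le>r. M_coeff r i l * vb * psi_entry r l j) = ?e * vb * (\<Sum>l\<le>r. psi_entry r l j)"
      unfolding sum_distrib_left using True by (intro sum.cong) (auto simp: M_coeff_def M_edge_def M_edge2_def)
    \<comment> \<open>Base value \<open>?e ^ 2\<close>; an edge adds \<open>1 - ?e\<close>, at
      \<open>r + i\<close> and \<open>r + i + 1\<close>, and a two-step path adds
      \<open>?e - ?e ^ 2\<close>, above \<open>r\<close> only at \<open>2 * r + 1\<close>.\<close>
    moreover have "(\<Sum>l=r+1..2*r+1. M_coeff r i l) = (\<Sum>l=r+1..2*r+1. (if l = r + i then 1 - ?e else 0)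
        + (if l = r + i + 1 then 1 - ?e else 0) + (if l = 2 * r + 1 then ?e - ?e ^ 2 else 0) + ?e ^ 2)"
      using True by (intro sum.cong) (auto simp: M_coeff_def M_edge_def M_edge2_def algebra_simps)
    then have "(\<Sum>l=r+1..2*r+1. M_coeff r i l) = (1 - ?e) + (1 - ?e) + (?e - ?e ^ 2) + (?\<rho> + 1) * ?e ^ 2"
      using True by (simp add: sum.distrib add.commute[of 1])
    ultimately have sum: "(\<Sum>l<2 * r + 2. M_coeff r i l * vb * psi_entry r l j) =
        ?e * vb * ((1 + ?\<rho> * (va + vb)) * y + h) +
        ((1 - ?e) + (1 - ?e) + (?e - ?e ^ 2) + (?\<rho> + 1) * ?e ^ 2) * (vb * y)"
      unfolding split first by simp
    have P: "?e * P = M_coeff r i j - (1 - ?e) * C_entry r i j + ?e * vb * h"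
      using True j by (auto simp: P_def h_def M_coeff_def C_entry_def M_edge_def M_edge2_def vc_def
          mult_2_right algebra_simps power2_eq_square)
    have psi: "psi_entry r i j = (va + vb) * y + C_entry r i j"
      using True by (simp add: psi_eq vc_def)
    show ?thesis
      unfolding sum psi by (rule row_identity_c[OF \<rho> \<rho> y P])
  qed
qed

section \<open>From entries to the matrix identity\<close>

lemma matrix_C_entry:
  assumes "i < 2 * r + 2" "j < 2 * r + 2"
  shows "matrix_C r $$ (i, j) = C_entry r i j"
  using assms
  by (auto simp: matrix_C_def C_entry_def M_edge_def block_H_def block_B_def)

theorem proposition4p3:
  fixes r :: nat
  shows "Psi_mat (matrix_M r) =
    vec_p r * mat 1 1 (\<lambda>_. phi r) * vec_p_dagger r + matrix_C r"
proof (rule eq_matI)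
  have dim: "dim_row (matrix_C r) = 2 * r + 2" "dim_col (matrix_C r) = 2 * r + 2"
    by (simp_all add: matrix_C_def block_H_def)
  show "dim_row (Psi_mat (matrix_M r)) = dim_row (vec_p r * mat 1 1 (\<lambda>_. phi r) * vec_p_dagger r + matrix_C r)"
    "dim_col (Psi_mat (matrix_M r)) = dim_col (vec_p r * mat 1 1 (\<lambda>_. phi r) * vec_p_dagger r + matrix_C r)"
    by (simp_all add: Psi_mat_def dim)
  fix i j
  assume "i < dim_row (vec_p r * mat 1 1 (\<lambda>_. phi r) * vec_p_dagger r + matrix_C r)"
    "j < dim_col (vec_p r * mat 1 1 (\<lambda>_. phi r) * vec_p_dagger r + matrix_C r)"
  then have ij: "i < 2 * r + 2" "j < 2 * r + 2" by (simp_all add: dim)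
  have "Psi_mat (matrix_M r) $$ (i, j) = level_Psi (matrix_M r) i j"
    using ij by (simp add: Psi_mat_def)
  also have "\<dots> = psi_entry r i j"
    using ij by (intro level_Psi_matrix_M_unique[where G = "\<lambda>i. psi_entry r i j"] psi_entry_rec)
  also have "\<dots> = (vec_p r * mat 1 1 (\<lambda>_. phi r) * vec_p_dagger r + matrix_C r) $$ (i, j)"
    using ij by (simp add: psi_entry_def matrix_C_entry dim vec_p_def vec_p_dagger_def scalar_prod_def)
  finally show "Psi_mat (matrix_M r) $$ (i, j) =
      (vec_p r * mat 1 1 (\<lambda>_. phi r) * vec_p_dagger r + matrix_C r) $$ (i, j)" .
qed

end
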